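(* Every weakly dominated dcpo belongs to $\mathcal R_2$. Consequently, $\mathbf{WDomi}\subseteq\mathcal R_2$, where $\mathbf{WDomi}$ is the class (full subcategory) of weakly dominated dcpos.
   Context: Directed subsets are nonempty; a dcpo is a poset in which every directed subset has a supremum. $\mathbf{DCPO}$ is the category of dcpos and Scott-continuous maps. For dcpos $A,B$, $[A\to B]$ is the dcpo of Scott-continuous maps ordered pointwise. All full subcategories are closed under isomorphisms. $\Gamma(P)$ is the complete lattice of Scott-closed subsets of $P$ ordered by inclusion. For a poset $Q$ and $x,y\in Q$, write $x\prec^*y$ if for every nonempty Scott-closed subset $\mathcal A\subseteq Q$ whose supremum exists, $y\le\bigvee\mathcal A$ implies $x\in\mathcal A$. An element $x$ is $C$-compact if $x\prec^*x$. For a dcpo $P$, $C(\Gamma(P))$ is the set of $C$-compact elements of $\Gamma(P)$, ordered by inclusion (it is a sub-dcpo of $\Gamma(P)$). For $A,B\in C(\Gamma(P))$ write $A\lhd B$ if $A\subseteq{\downarrow}b$ for some $b\in B$, and put $\nabla_CB=\{A\in C(\Gamma(P)):A\lhd B\}$. A dcpo $P$ is weakly dominated if $\nabla_CB$ is Scott closed in $C(\Gamma(P))$ for every $B\in C(\Gamma(P))$. Let $2=\{0<1\}$. $E_2$ is the class of all Scott-continuous maps $e:A\to B$ between dcpos such that $e^*:[B\to 2]\to[A\to 2]$, $g\mapsto g\circ e$, is an isomorphism of dcpos (equivalently, $e^{-1}$ is an order isomorphism from the lattice of Scott-open sets of $B$ onto that of $A$). $\mathcal R_2=E_2^{\perp}$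 is the full subcategory of $\mathbf{DCPO}$ of all dcpos $C$ such that for every $e:A\to B$ in $E_2$ the map $e^*:[B\to C]\to[A\to C]$, $g\mapsto g\circ e$, is an isomorphism of dcpos. (It is the least reflective full subcategory of $\mathbf{DCPO}$ containing $2$.) *)

theory Defs
  imports "HOL-Algebra.Order"
begin

definition directed_in :: "('a, 'm) gorder_scheme \<Rightarrow> 'a set \<Rightarrow> bool" where
  "directed_in L D \<longleftrightarrow> D \<subseteq> carrier L \<and> D \<noteq> {} \<and>
     (\<forall>x\<in>D. \<forall>y\<in>D. \<exists>z\<in>D. x \<sqsubseteq>\<^bsub>L\<^esub> z \<and> y \<sqsubseteq>\<^bsub>L\<^esub> z)"

text \<open>The carrier of a dcpo may be empty, and a dcpo need not have a least element.\<close>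

locale dcpo = partial_order +
  assumes directed_lub: "directed_in L D \<Longrightarrow> \<exists>s. is_lub L s D"

definition scott_continuous ::
    "('a, 'm) gorder_scheme \<Rightarrow> ('b, 'n) gorder_scheme \<Rightarrow> ('a \<Rightarrow> 'b) \<Rightarrow> bool" where
  "scott_continuous A B f \<longleftrightarrow>
     f \<in> carrier A \<rightarrow> carrier B \<and>
     (\<forall>x\<in>carrier A. \<forall>y\<in>carrier A. x \<sqsubseteq>\<^bsub>A\<^esub> y \<longrightarrow> f x \<sqsubseteq>\<^bsub>B\<^esub> f y) \<and>
     (\<forall>D s. directed_in A D \<and> is_lub A s D \<longrightarrow> is_lub B (f s) (f ` D))"

text \<open>
  Maps between carriers are represented by functions that are \<^const>\<open>undefined\<close> off the
  carrier (\<^const>\<open>extensional\<close>), so that each map has exactly one representative.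
\<close>

definition fun_dcpo :: "('a, 'm) gorder_scheme \<Rightarrow> ('b, 'n) gorder_scheme \<Rightarrow> ('a \<Rightarrow> 'b) gorder"
  where "fun_dcpo A B =
    \<lparr> carrier = {f \<in> extensional (carrier A). scott_continuous A B f},
      eq = (=),
      le = (\<lambda>f g. \<forall>x\<in>carrier A. f x \<sqsubseteq>\<^bsub>B\<^esub> g x) \<rparr>"

definition dcpo_iso ::
    "('a, 'm) gorder_scheme \<Rightarrow> ('b, 'n) gorder_scheme \<Rightarrow> ('a \<Rightarrow> 'b) \<Rightarrow> bool" where
  "dcpo_iso A B f \<longleftrightarrow> scott_continuous A B f \<and>
     (\<exists>g. scott_continuous B A g \<and>
       (\<forall>x\<in>carrier A. g (f x) = x) \<and> (\<forall>y\<in>carrier B. f (g y) = y))"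

definition two :: "bool gorder" where
  "two = \<lparr> carrier = UNIV, eq = (=), le = (\<le>) \<rparr>"

definition precomp ::
    "('a, 'm) gorder_scheme \<Rightarrow> ('a \<Rightarrow> 'b) \<Rightarrow> ('b \<Rightarrow> 'c) \<Rightarrow> ('a \<Rightarrow> 'c)" where
  "precomp A e = (\<lambda>g. compose (carrier A) g e)"

text \<open>\<open>E2 A B\<close> is the class $E_2$ restricted to the maps from \<open>A\<close> to \<open>B\<close>.\<close>

definition E2 :: "'a gorder \<Rightarrow> 'b gorder \<Rightarrow> ('a \<Rightarrow> 'b) set" where
  "E2 A B = {e \<in> carrier (fun_dcpo A B).
     dcpo A \<and> dcpo B \<and> dcpo_iso (fun_dcpo B two) (fun_dcpo A two) (precomp A e)}"

text \<open>
  The class $E_2$ ranges over dcpos of arbitrary size, whereas a HOL formula cannot quantify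
  over types. Hence the types carrying the domain and the codomain of the test maps are
  parameters of \<open>R2\<close>. To say that \<open>C\<close> belongs to $\mathcal R_2$ is to assert
  \<open>C \<in> R2 TYPE('a) TYPE('b)\<close> for all types \<open>'a\<close> and \<open>'b\<close>, that is, with both
  of them free in the theorem.
\<close>

definition R2 :: "'a itself \<Rightarrow> 'b itself \<Rightarrow> 'c gorder set" where
  "R2 _ _ = {C. dcpo C \<and>
     (\<forall>(A :: 'a gorder) (B :: 'b gorder). \<forall>e\<in>E2 A B.
        dcpo_iso (fun_dcpo B C) (fun_dcpo A C) (precomp A e))}"

text \<open>
  \<open>Q\<close> is only a poset here, so closure under directed suprema refers to those that exist.
  The empty set is Scott closed.
\<close>

definition scott_closed :: "('a, 'm) gorder_scheme \<Rightarrow> 'a set \<Rightarrow> bool" where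
  "scott_closed Q S \<longleftrightarrow> S \<subseteq> carrier Q \<and>
     (\<forall>x\<in>S. \<forall>y\<in>carrier Q. y \<sqsubseteq>\<^bsub>Q\<^esub> x \<longrightarrow> y \<in> S) \<and>
     (\<forall>D s. D \<subseteq> S \<and> directed_in Q D \<and> is_lub Q s D \<longrightarrow> s \<in> S)"

definition Gamma :: "('a, 'm) gorder_scheme \<Rightarrow> 'a set gorder" where
  "Gamma P = \<lparr> carrier = {S. scott_closed P S}, eq = (=), le = (\<subseteq>) \<rparr>"

definition prec_star :: "('a, 'm) gorder_scheme \<Rightarrow> 'a \<Rightarrow> 'a \<Rightarrow> bool" where
  "prec_star Q x y \<longleftrightarrow>
     (\<forall>S s. scott_closed Q S \<and> S \<noteq> {} \<and> is_lub Q s S \<and> y \<sqsubseteq>\<^bsub>Q\<^esub> s \<longrightarrow> x \<in> S)"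

definition C_compact :: "('a, 'm) gorder_scheme \<Rightarrow> 'a \<Rightarrow> bool" where
  "C_compact Q x \<longleftrightarrow> x \<in> carrier Q \<and> prec_star Q x x"

definition C_Gamma :: "('a, 'm) gorder_scheme \<Rightarrow> 'a set gorder" where
  "C_Gamma P = \<lparr> carrier = {S. C_compact (Gamma P) S}, eq = (=), le = (\<subseteq>) \<rparr>"

definition down :: "('a, 'm) gorder_scheme \<Rightarrow> 'a \<Rightarrow> 'a set" where
  "down P b = {x \<in> carrier P. x \<sqsubseteq>\<^bsub>P\<^esub> b}"

definition tri_below :: "('a, 'm) gorder_scheme \<Rightarrow> 'a set \<Rightarrow> 'a set \<Rightarrow> bool" where
  "tri_below P A B \<longleftrightarrow> (\<exists>b\<in>B. A \<subseteq> down P b)"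

definition nabla_C :: "('a, 'm) gorder_scheme \<Rightarrow> 'a set \<Rightarrow> 'a set set" where
  "nabla_C P B = {A \<in> carrier (C_Gamma P). tri_below P A B}"

definition weakly_dominated :: "('a, 'm) gorder_scheme \<Rightarrow> bool" where
  "weakly_dominated P \<longleftrightarrow> dcpo P \<and>
     (\<forall>B\<in>carrier (C_Gamma P). scott_closed (C_Gamma P) (nabla_C P B))"

definition WDomi :: "'a gorder set" where
  "WDomi = {P. weakly_dominated P}"

end

theory Submission
  imports Defs
begin

text \<open>
  Order reflection of \<open>precomp A e\<close> into any dcpo holds because the sets \<open>down P p\<close> are
  Scott closed and \<open>e\<close> induces an isomorphism of the lattices of Scott-closed sets. For
  surjectivity, a Scott-continuous \<open>f\<close> from \<open>A\<close> to \<open>P\<close> is extended to \<open>B\<close> with values in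
  $\Gamma(P)$, by sending \<open>b\<close> to the closure $\varphi(b)$ of the set of all \<open>f a\<close> with \<open>e a\<close>
  below \<open>b\<close>. Each $\varphi(b)$ is \<open>C\<close>-compact. The preimage of $\nabla_C\varphi(b)$ under
  $\varphi$ is Scott closed by weak domination, and its preimage under \<open>e\<close> contains that of
  \<open>down B b\<close>. Hence \<open>b\<close> lies in it, that is, $\varphi(b)\lhd\varphi(b)$, which makes
  $\varphi(b)$ a principal ideal. Its generator is the value of the extension at \<open>b\<close>.
\<close>

section \<open>Suprema, Scott-closed sets and closures\<close>

text \<open>\<open>Upper\<close> tests only those elements of \<open>X\<close> that lie in the
  carrier, which explains the intersections.\<close>

lemma is_lub_iff:
  "is_lub L s X \<longleftrightarrow> s \<in> carrier L \<and> (\<forall>x\<in>X \<inter> carrier L. x \<sqsubseteq>\<^bsub>L\<^esub> s) \<and>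
     (\<forall>u\<in>carrier L. (\<forall>x\<in>X \<inter> carrier L. x \<sqsubseteq>\<^bsub>L\<^esub> u) \<longrightarrow> s \<sqsubseteq>\<^bsub>L\<^esub> u)"
  unfolding least_def Upper_def by blast

lemma is_lub_two: "is_lub two s X \<longleftrightarrow> s = (True \<in> X)"
proof -
  have "is_lub two s X \<longleftrightarrow> (\<forall>x\<in>X. x \<longrightarrow> s) \<and> (\<forall>u. (\<forall>x\<in>X. x \<longrightarrow> u) \<longrightarrow> s \<longrightarrow> u)"
    unfolding is_lub_iff two_def by simp
  also have "\<dots> \<longleftrightarrow> (True \<in> X \<longrightarrow> s) \<and> (s \<longrightarrow> True \<in> X)"
    by (metis (full_types))
  finally show ?thesis by blast
qed

lemma scott_closedI:
  assumes "S \<subseteq> carrier Q"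
    and "\<And>x y. x \<in> S \<Longrightarrow> y \<in> carrier Q \<Longrightarrow> y \<sqsubseteq>\<^bsub>Q\<^esub> x \<Longrightarrow> y \<in> S"
    and "\<And>D s. D \<subseteq> S \<Longrightarrow> directed_in Q D \<Longrightarrow> is_lub Q s D \<Longrightarrow> s \<in> S"
  shows "scott_closed Q S"
  using assms unfolding scott_closed_def by blast

lemma scott_closed_carrier: "scott_closed Q (carrier Q)"
  by (rule scott_closedI) (auto simp: is_lub_iff)

lemma scott_closed_Inter:
  assumes "\<S> \<noteq> {}" and "\<And>S. S \<in> \<S> \<Longrightarrow> scott_closed Q S"
  shows "scott_closed Q (\<Inter>\<S>)"
  using assms unfolding scott_closed_def by blast

lemma scott_closed_down:
  assumes "partial_order P" "p \<in> carrier P"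
  shows "scott_closed P (down P p)"
proof -
  interpret partial_order P by fact
  show ?thesis
  proof (rule scott_closedI)
    show "y \<in> down P p" if "x \<in> down P p" "y \<in> carrier P" "y \<sqsubseteq>\<^bsub>P\<^esub> x" for x y
      using that assms(2) le_trans by (auto simp: down_def)
    show "s \<in> down P p" if "D \<subseteq> down P p" "is_lub P s D" for D s
      using that assms(2) by (auto simp: down_def is_lub_iff)
  qed (auto simp: down_def)
qed

lemma down_subset_down_iff:
  assumes "partial_order P" "x \<in> carrier P" "y \<in> carrier P"
  shows "down P x \<subseteq> down P y \<longleftrightarrow> x \<sqsubseteq>\<^bsub>P\<^esub> y"
proof -
  interpret partial_order P by fact
  have "z \<sqsubseteq>\<^bsub>P\<^esub> y" if "x \<sqsubseteq>\<^bsub>P\<^esub> y" "z \<in> carrier P" "z \<sqsubseteq>\<^bsub>P\<^esub> x" for z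
    using le_trans[OF that(3,1)] that(2) assms(2,3) by blast
  then show ?thesis using assms(2,3) by (auto simp: down_def)
qed

text \<open>The topological closure for the Scott topology. If \<open>X\<close> leaves the carrier,
  no closed set contains it and the intersection is \<open>UNIV\<close>; hence the hypothesis of
  \<open>scott_closed_scott_closure\<close>.\<close>

definition scott_closure :: "('a, 'm) gorder_scheme \<Rightarrow> 'a set \<Rightarrow> 'a set" where
  "scott_closure P X = \<Inter>{S. scott_closed P S \<and> X \<subseteq> S}"

lemma scott_closed_scott_closure:
  "X \<subseteq> carrier P \<Longrightarrow> scott_closed P (scott_closure P X)"
  unfolding scott_closure_def using scott_closed_carrier by (intro scott_closed_Inter) auto

lemma scott_closure_subset_iff:
  "scott_closed P S \<Longrightarrow> scott_closure P X \<subseteq> S \<longleftrightarrow> X \<subseteq> S"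
  unfolding scott_closure_def by blast

lemma directed_image:
  assumes "directed_in A D" "f \<in> carrier A \<rightarrow> carrier B"
    and "\<And>x y. x \<in> carrier A \<Longrightarrow> y \<in> carrier A \<Longrightarrow> x \<sqsubseteq>\<^bsub>A\<^esub> y \<Longrightarrow> f x \<sqsubseteq>\<^bsub>B\<^esub> f y"
  shows "directed_in B (f ` D)"
proof -
  have D: "D \<subseteq> carrier A" "D \<noteq> {}"
    and up: "\<And>x y. x \<in> D \<Longrightarrow> y \<in> D \<Longrightarrow> \<exists>z\<in>D. x \<sqsubseteq>\<^bsub>A\<^esub> z \<and> y \<sqsubseteq>\<^bsub>A\<^esub> z"
    using assms(1) unfolding directed_in_def by auto
  have "\<exists>z\<in>D. f x \<sqsubseteq>\<^bsub>B\<^esub> f z \<and> f y \<sqsubseteq>\<^bsub>B\<^esub> f z" if "x \<in> D" "y \<in> D" for x y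
    using up[OF that] that D(1) assms(3) by (meson subsetD)
  then show ?thesis
    using D assms(2) unfolding directed_in_def by auto
qed

lemma scott_continuous_vimage_closed:
  assumes "scott_continuous A B f" "scott_closed B S"
  shows "scott_closed A {a \<in> carrier A. f a \<in> S}"
proof (rule scott_closedI)
  show "y \<in> {a \<in> carrier A. f a \<in> S}"
    if "x \<in> {a \<in> carrier A. f a \<in> S}" "y \<in> carrier A" "y \<sqsubseteq>\<^bsub>A\<^esub> x" for x y
  proof -
    have "f y \<in> carrier B" "f y \<sqsubseteq>\<^bsub>B\<^esub> f x"
      using that assms(1) unfolding scott_continuous_def by auto
    then show ?thesis using that assms(2) unfolding scott_closed_def by blast
  qed
  show "s \<in> {a \<in> carrier A. f a \<in> S}"
    if "D \<subseteq> {a \<in> carrier A. f a \<in> S}" "directed_in A D" "is_lub A s D" for D s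
  proof -
    have "f ` D \<subseteq> S" using that(1) by blast
    moreover have "directed_in B (f ` D)"
      using that(2) assms(1) directed_image[of A D f B] unfolding scott_continuous_def by blast
    moreover have "is_lub B (f s) (f ` D)"
      using that(2,3) assms(1) unfolding scott_continuous_def by blast
    ultimately have "f s \<in> S" using assms(2) unfolding scott_closed_def by blast
    then show ?thesis using that(3) by (simp add: is_lub_iff)
  qed
qed auto

section \<open>Scott-closed families of Scott-closed sets\<close>

lemma scott_closed_Gamma_member:
  assumes "scott_closed (Gamma P) \<C>" "S \<in> \<C>"
  shows "scott_closed P S"
proof -
  have "\<C> \<subseteq> carrier (Gamma P)" using assms(1) unfolding scott_closed_def by (rule conjunct1)
  then show ?thesis using assms(2) by (auto simp: Gamma_def)
qed

lemma scott_closed_Gamma_lower: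
  assumes "scott_closed (Gamma P) \<C>" "S \<in> \<C>" "scott_closed P T" "T \<subseteq> S"
  shows "T \<in> \<C>"
proof -
  have "T \<in> carrier (Gamma P)" "T \<sqsubseteq>\<^bsub>Gamma P\<^esub> S" using assms by (simp_all add: Gamma_def)
  with assms(1,2) show ?thesis unfolding scott_closed_def by blast
qed

lemma down_subset:
  "scott_closed P S \<Longrightarrow> x \<in> S \<Longrightarrow> down P x \<subseteq> S"
  unfolding scott_closed_def down_def by blast

text \<open>A closed family contains \<open>down P x\<close> for every point \<open>x\<close> of its
  union, and \<open>down P\<close> carries directed suprema of \<open>P\<close> to suprema in
  \<open>Gamma P\<close>. The result identifies the supremum of such a family with its
  union.\<close>

lemma scott_closed_Union_Gamma:
  assumes P: "partial_order P" and C: "scott_closed (Gamma P) \<C>"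
  shows "scott_closed P (\<Union>\<C>)"
proof -
  interpret partial_order P by fact
  have closed: "scott_closed P S" if "S \<in> \<C>" for S
    by (rule scott_closed_Gamma_member[OF C that])
  have down: "down P x \<in> \<C>" if x: "x \<in> \<Union>\<C>" for x
  proof -
    obtain S where S: "S \<in> \<C>" "x \<in> S" using x by blast
    then have "x \<in> carrier P" "down P x \<subseteq> S"
      using closed[of S] down_subset[of P S x] unfolding scott_closed_def by auto
    then show ?thesis using scott_closed_Gamma_lower[OF C S(1)] scott_closed_down[OF P] by blast
  qed
  show ?thesis
  proof (rule scott_closedI)
    show "\<Union>\<C> \<subseteq> carrier P" using closed unfolding scott_closed_def by blast
    show "y \<in> \<Union>\<C>" if "x \<in> \<Union>\<C>" "y \<in> carrier P" "y \<sqsubseteq>\<^bsub>P\<^esub> x" for x y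
      using that closed unfolding scott_closed_def by blast
    fix D s assume D: "D \<subseteq> \<Union>\<C>" "directed_in P D" "is_lub P s D"
    have s: "s \<in> carrier P" using D(3) by (simp add: is_lub_iff)
    have Dc: "D \<subseteq> carrier P" using D(2) unfolding directed_in_def by blast
    have "directed_in (Gamma P) (down P ` D)"
      by (rule directed_image[OF D(2)])
        (simp_all add: Gamma_def scott_closed_down[OF P] down_subset_down_iff[OF P])
    \<comment> \<open>An upper bound \<open>U\<close> contains every \<open>d\<close> in
      \<open>D\<close>. Being Scott closed, it contains \<open>s\<close> and then all of
      \<open>down P s\<close>.\<close>
    moreover have "is_lub (Gamma P) (down P s) (down P ` D)"
      unfolding is_lub_iff
    proof (intro conjI ballI impI)
      show "down P s \<in> carrier (Gamma P)"
        using s by (simp add: Gamma_def scott_closed_down[OF P])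
      show "X \<sqsubseteq>\<^bsub>Gamma P\<^esub> down P s" if X: "X \<in> down P ` D \<inter> carrier (Gamma P)" for X
      proof -
        obtain d where d: "d \<in> D" "X = down P d" using X by blast
        then have "d \<in> carrier P" "d \<sqsubseteq>\<^bsub>P\<^esub> s" using D(3) Dc by (auto simp: is_lub_iff)
        then show ?thesis using d s by (simp add: Gamma_def down_subset_down_iff[OF P])
      qed
      fix U assume U: "U \<in> carrier (Gamma P)"
        and ub: "\<forall>X\<in>down P ` D \<inter> carrier (Gamma P). X \<sqsubseteq>\<^bsub>Gamma P\<^esub> U"
      have cU: "scott_closed P U" using U by (simp add: Gamma_def)
      have "D \<subseteq> U"
      proof
        fix d assume d: "d \<in> D"
        then have "down P d \<subseteq> U"
          using ub Dc scott_closed_down[OF P, of d] by (force simp: Gamma_def)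
        then show "d \<in> U" using d Dc by (auto simp: down_def subset_iff)
      qed
      then have "s \<in> U" using cU D unfolding scott_closed_def by blast
      then show "down P s \<sqsubseteq>\<^bsub>Gamma P\<^esub> U"
        using cU unfolding scott_closed_def by (auto simp: Gamma_def down_def)
    qed
    moreover have "down P ` D \<subseteq> \<C>" using D(1) down by auto
    ultimately have "down P s \<in> \<C>" using C unfolding scott_closed_def[of "Gamma P"] by blast
    moreover have "s \<in> down P s" using s by (simp add: down_def)
    ultimately show "s \<in> \<Union>\<C>" by blast
  qed
qed

section \<open>Isomorphisms of function spaces\<close>

text \<open>An upper bound \<open>u\<close> of the image pulls back to the upper bound
  \<open>g u\<close> of \<open>D\<close>, and the order equivalence carries the comparison with
  \<open>s\<close> over again.\<close>

lemma order_iso_scott_continuous: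
  assumes f: "f \<in> carrier A \<rightarrow> carrier B"
    and g: "g \<in> carrier B \<rightarrow> carrier A" and fg: "\<And>y. y \<in> carrier B \<Longrightarrow> f (g y) = y"
    and mono: "\<And>x y. x \<in> carrier A \<Longrightarrow> y \<in> carrier A \<Longrightarrow> f x \<sqsubseteq>\<^bsub>B\<^esub> f y \<longleftrightarrow> x \<sqsubseteq>\<^bsub>A\<^esub> y"
  shows "scott_continuous A B f"
  unfolding scott_continuous_def
proof (intro conjI allI impI ballI)
  fix D s assume "directed_in A D \<and> is_lub A s D"
  then have D: "D \<subseteq> carrier A" and s: "is_lub A s D" unfolding directed_in_def by auto
  show "is_lub B (f s) (f ` D)"
    unfolding is_lub_iff
  proof (intro conjI ballI impI)
    show "f s \<in> carrier B" using s f by (auto simp: is_lub_iff)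
    show "x \<sqsubseteq>\<^bsub>B\<^esub> f s" if "x \<in> f ` D \<inter> carrier B" for x
      using that s D mono by (auto simp: is_lub_iff)
    fix u assume u: "u \<in> carrier B" "\<forall>x\<in>f ` D \<inter> carrier B. x \<sqsubseteq>\<^bsub>B\<^esub> u"
    have gu: "g u \<in> carrier A" using u(1) g by auto
    have "x \<sqsubseteq>\<^bsub>A\<^esub> g u" if "x \<in> D" for x
      using mono[of x "g u"] that D u f fg[OF u(1)] gu by (auto simp: subset_iff Pi_iff)
    then have "s \<sqsubseteq>\<^bsub>A\<^esub> g u" using s gu by (auto simp: is_lub_iff)
    then show "f s \<sqsubseteq>\<^bsub>B\<^esub> u" using mono[of s "g u"] s gu fg u(1) by (simp add: is_lub_iff)
  qed
qed (use f mono in auto)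

text \<open>Applied to function spaces, this avoids any computation of directed suprema of maps: an
  order isomorphism preserves whichever suprema exist.\<close>

lemma dcpo_isoI:
  assumes f: "f \<in> carrier A \<rightarrow> carrier B"
    and g: "g \<in> carrier B \<rightarrow> carrier A"
    and gf: "\<And>x. x \<in> carrier A \<Longrightarrow> g (f x) = x" and fg: "\<And>y. y \<in> carrier B \<Longrightarrow> f (g y) = y"
    and mono: "\<And>x y. x \<in> carrier A \<Longrightarrow> y \<in> carrier A \<Longrightarrow> f x \<sqsubseteq>\<^bsub>B\<^esub> f y \<longleftrightarrow> x \<sqsubseteq>\<^bsub>A\<^esub> y"
  shows "dcpo_iso A B f"
proof -
  have "g x \<sqsubseteq>\<^bsub>A\<^esub> g y \<longleftrightarrow> x \<sqsubseteq>\<^bsub>B\<^esub> y" if "x \<in> carrier B" "y \<in> carrier B" for x y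
    using mono[of "g x" "g y"] that g fg by auto
  then have "scott_continuous B A g"
    using order_iso_scott_continuous[of g B A f] f g gf by blast
  moreover have "scott_continuous A B f"
    using order_iso_scott_continuous[of f A B g] f g fg mono by blast
  ultimately show ?thesis unfolding dcpo_iso_def using gf fg by blast
qed

text \<open>Passes between an extensional representative and the plain formula that defines it on
  the carrier.\<close>

lemma scott_continuous_cong:
  assumes "\<And>x. x \<in> carrier A \<Longrightarrow> f x = g x"
  shows "scott_continuous A B f \<longleftrightarrow> scott_continuous A B g"
proof -
  have "f ` D = g ` D" if "directed_in A D" for D
    using that assms unfolding directed_in_def by (intro image_cong) auto
  moreover have "f s = g s" if "is_lub A s D" for s D
    using that assms by (simp add: is_lub_iff)
  ultimately have "(\<forall>D s. directed_in A D \<and> is_lub A s D \<longrightarrow> is_lub B (f s) (f ` D)) \<longleftrightarrow>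
      (\<forall>D s. directed_in A D \<and> is_lub A s D \<longrightarrow> is_lub B (g s) (g ` D))"
    by metis
  moreover have "f \<in> carrier A \<rightarrow> carrier B \<longleftrightarrow> g \<in> carrier A \<rightarrow> carrier B"
    using assms by (auto simp: Pi_def)
  ultimately show ?thesis unfolding scott_continuous_def by (simp add: assms)
qed

lemma scott_continuous_compose:
  assumes f: "scott_continuous A B f" and g: "scott_continuous B C g"
  shows "scott_continuous A C (\<lambda>x. g (f x))"
  unfolding scott_continuous_def
proof (intro conjI allI impI ballI)
  show "(\<lambda>x. g (f x)) \<in> carrier A \<rightarrow> carrier C"
    using f g unfolding scott_continuous_def by auto
  show "g (f x) \<sqsubseteq>\<^bsub>C\<^esub> g (f y)" if "x \<in> carrier A" "y \<in> carrier A" "x \<sqsubseteq>\<^bsub>A\<^esub> y" for x y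
    using that f g unfolding scott_continuous_def by (simp add: Pi_iff)
  fix D s assume "directed_in A D \<and> is_lub A s D"
  moreover from this have "directed_in B (f ` D)"
    using f directed_image[of A D f B] unfolding scott_continuous_def by blast
  ultimately have "is_lub C (g (f s)) (g ` f ` D)"
    using f g unfolding scott_continuous_def by blast
  then show "is_lub C (g (f s)) ((\<lambda>x. g (f x)) ` D)" by (simp add: image_image)
qed

lemma precomp_in_fun_dcpo:
  assumes "scott_continuous A B e" "g \<in> carrier (fun_dcpo B C)"
  shows "precomp A e g \<in> carrier (fun_dcpo A C)"
proof -
  have "scott_continuous A C (\<lambda>x. g (e x))"
    using assms scott_continuous_compose by (auto simp: fun_dcpo_def)
  then have "scott_continuous A C (precomp A e g)"
    using scott_continuous_cong[of A "precomp A e g" "\<lambda>x. g (e x)" C]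
    by (simp add: precomp_def compose_def)
  then show ?thesis by (simp add: fun_dcpo_def precomp_def)
qed

text \<open>A closed set is encoded by the indicator of its open complement, since \<open>S\<close>
  is a lower set and the map has to be monotone.\<close>

lemma char_in_fun_dcpo_two:
  assumes "scott_closed A S"
  shows "(\<lambda>a\<in>carrier A. a \<notin> S) \<in> carrier (fun_dcpo A two)"
proof -
  have "scott_continuous A two (\<lambda>a. a \<notin> S)"
    unfolding scott_continuous_def
  proof (intro conjI allI impI ballI)
    show "(x \<notin> S) \<sqsubseteq>\<^bsub>two\<^esub> (y \<notin> S)"
      if "x \<in> carrier A" "y \<in> carrier A" "x \<sqsubseteq>\<^bsub>A\<^esub> y" for x y
      using that assms unfolding scott_closed_def two_def by auto
    fix D s assume D: "directed_in A D \<and> is_lub A s D"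
    have "s \<in> S" if "D \<subseteq> S"
      using D that assms unfolding scott_closed_def by blast
    moreover have "d \<in> S" if "s \<in> S" "d \<in> D" for d
    proof -
      have "d \<in> carrier A" "d \<sqsubseteq>\<^bsub>A\<^esub> s"
        using D that(2) by (auto simp: is_lub_iff directed_in_def)
      then show ?thesis using assms that(1) unfolding scott_closed_def by blast
    qed
    \<comment> \<open>Closure under directed suprema gives one direction, the lower-set property the
      other.\<close>
    ultimately have "(\<forall>d\<in>D. d \<in> S) \<longleftrightarrow> s \<in> S" by blast
    then show "is_lub two (s \<notin> S) ((\<lambda>a. a \<notin> S) ` D)"
      unfolding is_lub_two by auto
  qed (auto simp: two_def)
  then show ?thesis
    using scott_continuous_cong[of A "\<lambda>a\<in>carrier A. a \<notin> S" "\<lambda>a. a \<notin> S" two]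
    by (simp add: fun_dcpo_def)
qed

lemma fun_dcpo_two_closed:
  assumes "g \<in> carrier (fun_dcpo B two)"
  shows "scott_closed B {b \<in> carrier B. \<not> g b}"
proof -
  have "scott_closed two {False}"
    by (rule scott_closedI) (auto simp: two_def is_lub_two[unfolded two_def])
  with assms show ?thesis
    using scott_continuous_vimage_closed[of B two g "{False}"] by (simp add: fun_dcpo_def)
qed

section \<open>Maps in $E_2$\<close>

lemma E2_continuous: "e \<in> E2 A B \<Longrightarrow> scott_continuous A B e"
  by (simp add: E2_def fun_dcpo_def)

text \<open>Surjectivity of \<open>precomp A e\<close> on maps into \<open>two\<close>, read on zero
  sets: the indicator of the complement of \<open>S\<close> factors through \<open>e\<close> as some
  \<open>g\<close>, and \<open>T\<close> is where \<open>g\<close> is false.\<close>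

lemma E2_closed_extend:
  assumes e: "e \<in> E2 A B" and S: "scott_closed A S"
  obtains T where "scott_closed B T" "\<And>a. a \<in> carrier A \<Longrightarrow> e a \<in> T \<longleftrightarrow> a \<in> S"
proof -
  let ?h = "\<lambda>a\<in>carrier A. a \<notin> S"
  obtain g where g: "g \<in> carrier (fun_dcpo B two)" "precomp A e g = ?h"
  proof -
    have "?h \<in> carrier (fun_dcpo A two)" by (rule char_in_fun_dcpo_two[OF S])
    moreover have "dcpo_iso (fun_dcpo B two) (fun_dcpo A two) (precomp A e)"
      using e by (simp add: E2_def)
    ultimately show thesis
      using that unfolding dcpo_iso_def scott_continuous_def by (meson PiE)
  qed
  show thesis
  proof (rule that)
    show "scott_closed B {b \<in> carrier B. \<not> g b}" by (rule fun_dcpo_two_closed[OF g(1)])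
    fix a assume a: "a \<in> carrier A"
    have "g (e a) \<longleftrightarrow> a \<notin> S"
      using fun_cong[OF g(2), of a] a by (simp add: precomp_def compose_def)
    moreover have "e a \<in> carrier B"
      using E2_continuous[OF e] a unfolding scott_continuous_def by auto
    ultimately show "e a \<in> {b \<in> carrier B. \<not> g b} \<longleftrightarrow> a \<in> S" by simp
  qed
qed

text \<open>Order reflection of \<open>precomp A e\<close> on maps into \<open>two\<close>, supplied
  by its monotone inverse \<open>k\<close>.\<close>

lemma E2_closed_reflect:
  assumes e: "e \<in> E2 A B" and S: "scott_closed B S" and T: "scott_closed B T"
    and sub: "\<And>a. a \<in> carrier A \<Longrightarrow> e a \<in> S \<Longrightarrow> e a \<in> T"
  shows "S \<subseteq> T"
proof -
  let ?\<chi> = "\<lambda>S. \<lambda>b\<in>carrier B. b \<notin> S"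
  obtain k where k: "scott_continuous (fun_dcpo A two) (fun_dcpo B two) k"
    "\<And>g. g \<in> carrier (fun_dcpo B two) \<Longrightarrow> k (precomp A e g) = g"
    using e unfolding E2_def dcpo_iso_def by blast
  have \<chi>: "?\<chi> S \<in> carrier (fun_dcpo B two)" "?\<chi> T \<in> carrier (fun_dcpo B two)"
    using char_in_fun_dcpo_two S T by blast+
  have eB: "e a \<in> carrier B" if "a \<in> carrier A" for a
    using E2_continuous[OF e] that unfolding scott_continuous_def by auto
  \<comment> \<open>Taking complements reverses inclusion, so \<open>T\<close> stands on the smaller
    side.\<close>
  have "precomp A e (?\<chi> T) \<sqsubseteq>\<^bsub>fun_dcpo A two\<^esub> precomp A e (?\<chi> S)"
    using sub eB by (auto simp: fun_dcpo_def two_def precomp_def compose_def)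
  moreover have "precomp A e (?\<chi> S) \<in> carrier (fun_dcpo A two)"
    "precomp A e (?\<chi> T) \<in> carrier (fun_dcpo A two)"
    using \<chi> precomp_in_fun_dcpo[OF E2_continuous[OF e]] by blast+
  ultimately have "k (precomp A e (?\<chi> T)) \<sqsubseteq>\<^bsub>fun_dcpo B two\<^esub> k (precomp A e (?\<chi> S))"
    using k(1) unfolding scott_continuous_def by simp
  then have "?\<chi> T \<sqsubseteq>\<^bsub>fun_dcpo B two\<^esub> ?\<chi> S" using k(2) \<chi> by simp
  then show ?thesis
    using S unfolding scott_closed_def by (auto simp: fun_dcpo_def two_def)
qed

text \<open>Compare the preimages of the closed set \<open>down P (h b)\<close> under
  \<open>h\<close> and \<open>g\<close>. The first contains \<open>b\<close>, and on points
  \<open>e a\<close> it lies in the second, so it does so everywhere.\<close>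

lemma E2_le_reflect:
  assumes e: "e \<in> E2 A B" and P: "partial_order P"
    and g: "scott_continuous B P g" and h: "scott_continuous B P h"
    and le: "\<And>a. a \<in> carrier A \<Longrightarrow> g (e a) \<sqsubseteq>\<^bsub>P\<^esub> h (e a)" and b: "b \<in> carrier B"
  shows "g b \<sqsubseteq>\<^bsub>P\<^esub> h b"
proof -
  interpret partial_order P by fact
  have hb: "h b \<in> carrier P" using h b unfolding scott_continuous_def by auto
  have gh: "g x \<in> carrier P" "h x \<in> carrier P" if "x \<in> carrier B" for x
    using g h that unfolding scott_continuous_def by auto
  let ?V = "\<lambda>k. {x \<in> carrier B. k x \<in> down P (h b)}"
  have "?V h \<subseteq> ?V g"
  proof (rule E2_closed_reflect[OF e])
    show "scott_closed B (?V h)" "scott_closed B (?V g)"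
      using scott_continuous_vimage_closed scott_closed_down[OF P hb] g h by blast+
    show "e a \<in> ?V g" if "a \<in> carrier A" "e a \<in> ?V h" for a
      using that le_trans[OF le[of a], of "h b"] gh hb by (simp add: down_def)
  qed
  moreover have "b \<in> ?V h" using b hb by (simp add: down_def)
  ultimately show ?thesis by (auto simp: down_def)
qed

section \<open>The extension with values in $\Gamma(P)$\<close>

locale E2_extension =
  fixes A :: "'a gorder" and B :: "'b gorder" and P :: "'c gorder" and e f
  assumes e: "e \<in> E2 A B" and P: "partial_order P" and f: "scott_continuous A P f"
begin

text \<open>The closure stands in for the supremum of the values \<open>f a\<close>, which need not
  exist in \<open>P\<close>.\<close>

definition \<phi> :: "'b \<Rightarrow> 'c set" where
  "\<phi> b = scott_closure P (f ` {a \<in> carrier A. e a \<sqsubseteq>\<^bsub>B\<^esub> b})"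

lemma partial_order_B: "partial_order B"
  using e by (simp add: E2_def dcpo_def)

lemma e_closed: "a \<in> carrier A \<Longrightarrow> e a \<in> carrier B"
  using E2_continuous[OF e] unfolding scott_continuous_def by auto

lemma f_closed: "a \<in> carrier A \<Longrightarrow> f a \<in> carrier P"
  using f unfolding scott_continuous_def by auto

lemma \<phi>_closed: "scott_closed P (\<phi> b)"
  unfolding \<phi>_def using f_closed by (intro scott_closed_scott_closure) auto

lemma \<phi>_subset_iff:
  "scott_closed P S \<Longrightarrow> \<phi> b \<subseteq> S \<longleftrightarrow> (\<forall>a\<in>carrier A. e a \<sqsubseteq>\<^bsub>B\<^esub> b \<longrightarrow> f a \<in> S)"
  unfolding \<phi>_def by (auto simp: scott_closure_subset_iff)

text \<open>A density principle: \<open>b\<close> lies in the closure of the points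
  \<open>e a\<close> below it, by \<open>E2_closed_reflect\<close> for \<open>down B b\<close>. The
  later proofs choose a suitable closed \<open>T\<close> and check it on those points.\<close>

lemma mem_closed_if_below:
  assumes b: "b \<in> carrier B" and T: "scott_closed B T"
    and "\<And>a. a \<in> carrier A \<Longrightarrow> e a \<sqsubseteq>\<^bsub>B\<^esub> b \<Longrightarrow> e a \<in> T"
  shows "b \<in> T"
proof -
  interpret B: partial_order B by (rule partial_order_B)
  have "down B b \<subseteq> T"
    using assms by (intro E2_closed_reflect[OF e] scott_closed_down[OF partial_order_B])
      (auto simp: down_def)
  then show ?thesis using b by (auto simp: down_def)
qed

text \<open>
  The closed sets above \<open>\<phi> b\<close> are those whose preimage under \<open>f\<close>, transported to \<open>B\<close>, contains
  \<open>b\<close>. Continuity of \<open>\<phi>\<close> is immediate from this.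
\<close>

lemma \<phi>_transport:
  assumes S: "scott_closed P S"
  obtains T where "scott_closed B T" "\<And>a. a \<in> carrier A \<Longrightarrow> e a \<in> T \<longleftrightarrow> f a \<in> S"
    "\<And>b. b \<in> carrier B \<Longrightarrow> \<phi> b \<subseteq> S \<longleftrightarrow> b \<in> T"
proof -
  have "scott_closed A {a \<in> carrier A. f a \<in> S}"
    by (rule scott_continuous_vimage_closed[OF f S])
  from E2_closed_extend[OF e this] obtain T where T: "scott_closed B T"
    "\<And>a. a \<in> carrier A \<Longrightarrow> e a \<in> T \<longleftrightarrow> f a \<in> S" by (metis (mono_tags, lifting) mem_Collect_eq)
  have "\<phi> b \<subseteq> S \<longleftrightarrow> b \<in> T" if b: "b \<in> carrier B" for b
  proof
    show "b \<in> T" if "\<phi> b \<subseteq> S"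
      using that T mem_closed_if_below[OF b T(1)] by (auto simp: \<phi>_subset_iff[OF S])
    show "\<phi> b \<subseteq> S" if "b \<in> T"
      unfolding \<phi>_subset_iff[OF S]
      using that T e_closed unfolding scott_closed_def by blast
  qed
  with T show thesis by (rule that)
qed

text \<open>The closed set \<open>down P (f a)\<close> contains \<open>f a\<close>, so its transport
  to \<open>B\<close> contains \<open>e a\<close>, which bounds \<open>\<phi> (e a)\<close> from
  above. Conversely, \<open>a\<close> itself is one of the indices in
  \<open>\<phi> (e a)\<close>.\<close>

lemma \<phi>_e:
  assumes a: "a \<in> carrier A"
  shows "\<phi> (e a) = down P (f a)"
proof
  interpret P: partial_order P by (rule P)
  interpret B: partial_order B by (rule partial_order_B)
  have fa: "f a \<in> carrier P" by (rule f_closed[OF a])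
  obtain T where "e a \<in> T \<longleftrightarrow> f a \<in> down P (f a)"
    "\<phi> (e a) \<subseteq> down P (f a) \<longleftrightarrow> e a \<in> T"
    using \<phi>_transport[OF scott_closed_down[OF P fa]] a e_closed by metis
  then show "\<phi> (e a) \<subseteq> down P (f a)" using fa by (simp add: down_def)
  have "f a \<in> \<phi> (e a)"
    using \<phi>_subset_iff[OF \<phi>_closed, of "e a" "e a"] a e_closed by auto
  then show "down P (f a) \<subseteq> \<phi> (e a)" by (rule down_subset[OF \<phi>_closed])
qed

lemma \<phi>_mono:
  assumes "x \<in> carrier B" "y \<in> carrier B" "x \<sqsubseteq>\<^bsub>B\<^esub> y"
  shows "\<phi> x \<subseteq> \<phi> y"
proof -
  interpret B: partial_order B by (rule partial_order_B)
  have "f a \<in> \<phi> y" if "a \<in> carrier A" "e a \<sqsubseteq>\<^bsub>B\<^esub> x" for a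
    using \<phi>_subset_iff[OF \<phi>_closed, of y y] that assms e_closed B.le_trans by blast
  then show ?thesis by (simp add: \<phi>_subset_iff[OF \<phi>_closed])
qed

text \<open>The hypothesis puts \<open>D\<close> inside the transport of \<open>S\<close>, which is
  closed under directed suprema. With no target poset mentioned, this serves both for
  \<open>\<phi>\<close> and for the extension with values in \<open>P\<close>.\<close>

lemma \<phi>_lub_subset:
  assumes D: "directed_in B D" "is_lub B s D" and S: "scott_closed P S"
    and "\<And>d. d \<in> D \<Longrightarrow> \<phi> d \<subseteq> S"
  shows "\<phi> s \<subseteq> S"
proof -
  obtain T where T: "scott_closed B T" "\<And>b. b \<in> carrier B \<Longrightarrow> \<phi> b \<subseteq> S \<longleftrightarrow> b \<in> T"
    by (rule \<phi>_transport[OF S]) (rule that)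
  have "d \<in> T" if "d \<in> D" for d
    using T(2)[of d] assms(4)[OF that] D(1) that by (auto simp: directed_in_def)
  then have "D \<subseteq> T" by blast
  then have "s \<in> T" using T(1) D unfolding scott_closed_def by blast
  then show ?thesis using T(2) D(2) by (simp add: is_lub_iff)
qed

text \<open>\<open>Q\<close> is kept general to cover both \<open>Gamma P\<close> and
  \<open>C_Gamma P\<close>. Upper bounds in \<open>Q\<close> are still Scott-closed sets, so
  \<open>\<phi>_lub_subset\<close> applies to them.\<close>

lemma \<phi>_continuous_into:
  assumes Q: "carrier Q \<subseteq> carrier (Gamma P)" "le Q = (\<subseteq>)"
    and into: "\<And>b. b \<in> carrier B \<Longrightarrow> \<phi> b \<in> carrier Q"
  shows "scott_continuous B Q \<phi>"
  unfolding scott_continuous_def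
proof (intro conjI allI impI ballI)
  show "\<phi> \<in> carrier B \<rightarrow> carrier Q" using into by auto
  show "\<phi> x \<sqsubseteq>\<^bsub>Q\<^esub> \<phi> y" if "x \<in> carrier B" "y \<in> carrier B" "x \<sqsubseteq>\<^bsub>B\<^esub> y" for x y
    using \<phi>_mono that by (simp add: Q)
  fix D s assume D: "directed_in B D \<and> is_lub B s D"
  then have s: "s \<in> carrier B" and DB: "D \<subseteq> carrier B"
    by (auto simp: is_lub_iff directed_in_def)
  show "is_lub Q (\<phi> s) (\<phi> ` D)"
    unfolding is_lub_iff
  proof (intro conjI ballI impI)
    show "\<phi> s \<in> carrier Q" by (rule into[OF s])
    show "X \<sqsubseteq>\<^bsub>Q\<^esub> \<phi> s" if X: "X \<in> \<phi> ` D \<inter> carrier Q" for X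
    proof -
      obtain d where d: "d \<in> D" "X = \<phi> d" using X by blast
      then have "d \<sqsubseteq>\<^bsub>B\<^esub> s" using D DB by (auto simp: is_lub_iff)
      then show ?thesis using \<phi>_mono[of d s] d DB s by (auto simp: Q)
    qed
    fix U assume U: "U \<in> carrier Q" "\<forall>X\<in>\<phi> ` D \<inter> carrier Q. X \<sqsubseteq>\<^bsub>Q\<^esub> U"
    have "scott_closed P U" using U(1) Q(1) by (auto simp: Gamma_def)
    moreover have "\<phi> d \<subseteq> U" if "d \<in> D" for d
    proof -
      have "\<phi> d \<in> \<phi> ` D \<inter> carrier Q" using that DB into by auto
      then show ?thesis using U(2) by (simp add: Q(2))
    qed
    ultimately have "\<phi> s \<subseteq> U" using \<phi>_lub_subset D by blast
    then show "\<phi> s \<sqsubseteq>\<^bsub>Q\<^esub> U" by (simp add: Q)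
  qed
qed

lemma \<phi>_continuous_Gamma: "scott_continuous B (Gamma P) \<phi>"
  by (rule \<phi>_continuous_into) (auto simp: Gamma_def \<phi>_closed)

text \<open>The preimage of a closed family under \<open>\<phi>\<close> is closed in
  \<open>B\<close>. If the supremum of the family contains \<open>\<phi> b\<close>, each
  \<open>f a\<close> with \<open>e a\<close> below \<open>b\<close> lies in a member, so
  \<open>down P (f a)\<close>, which is \<open>\<phi> (e a)\<close>, belongs to the family. Density
  then yields \<open>b\<close>.\<close>

lemma \<phi>_C_compact:
  assumes b: "b \<in> carrier B"
  shows "C_compact (Gamma P) (\<phi> b)"
proof -
  have "\<phi> b \<in> \<C>" if C: "scott_closed (Gamma P) \<C>" and U: "is_lub (Gamma P) U \<C>" "\<phi> b \<subseteq> U"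
    for \<C> U
  proof -
    have "scott_closed P (\<Union>\<C>)" by (rule scott_closed_Union_Gamma[OF P C])
    then have "\<Union>\<C> \<in> carrier (Gamma P)" by (simp add: Gamma_def)
    moreover have "X \<sqsubseteq>\<^bsub>Gamma P\<^esub> \<Union>\<C>" if "X \<in> \<C>" for X using that by (auto simp: Gamma_def)
    \<comment> \<open>The union is a Scott-closed upper bound, so points of \<open>\<phi> b\<close>
      are found in members of the family.\<close>
    ultimately have "U \<sqsubseteq>\<^bsub>Gamma P\<^esub> \<Union>\<C>" using U(1) by (simp add: is_lub_iff)
    then have U': "\<phi> b \<subseteq> \<Union>\<C>" using U(2) by (simp add: Gamma_def)
    have "b \<in> {x \<in> carrier B. \<phi> x \<in> \<C>}"
    proof (rule mem_closed_if_below[OF b])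
      show "scott_closed B {x \<in> carrier B. \<phi> x \<in> \<C>}"
        by (rule scott_continuous_vimage_closed[OF \<phi>_continuous_Gamma C])
      fix a assume a: "a \<in> carrier A" "e a \<sqsubseteq>\<^bsub>B\<^esub> b"
      then have "f a \<in> \<phi> b" using \<phi>_subset_iff[OF \<phi>_closed, of b b] by auto
      then obtain S where S: "S \<in> \<C>" "f a \<in> S" using U' by auto
      have "down P (f a) \<subseteq> S"
        by (rule down_subset[OF scott_closed_Gamma_member[OF C S(1)] S(2)])
      moreover have "scott_closed P (down P (f a))"
        using scott_closed_down[OF P] f_closed a by blast
      ultimately have "down P (f a) \<in> \<C>"
        using scott_closed_Gamma_lower[OF C S(1)] by blast
      then show "e a \<in> {x \<in> carrier B. \<phi> x \<in> \<C>}" using a e_closed \<phi>_e by simp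
    qed
    then show ?thesis by simp
  qed
  then show ?thesis
    unfolding C_compact_def prec_star_def by (auto simp: Gamma_def \<phi>_closed)
qed

text \<open>Weak domination enters here: it makes the preimage of
  \<open>nabla_C P (\<phi> b)\<close> under \<open>\<phi>\<close> closed. Compactness of
  \<open>\<phi> b\<close> is what allows it to be applied.\<close>

lemma \<phi>_principal:
  assumes wd: "weakly_dominated P" and b: "b \<in> carrier B"
  obtains p where "p \<in> carrier P" "\<phi> b = down P p"
proof -
  let ?N = "nabla_C P (\<phi> b)"
  have "scott_continuous B (C_Gamma P) \<phi>"
  proof (rule \<phi>_continuous_into)
    show "carrier (C_Gamma P) \<subseteq> carrier (Gamma P)"
      by (auto simp: C_Gamma_def C_compact_def)
  qed (simp_all add: C_Gamma_def \<phi>_C_compact)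
  moreover have "scott_closed (C_Gamma P) ?N"
    using wd \<phi>_C_compact[OF b] by (simp add: weakly_dominated_def C_Gamma_def)
  ultimately have "scott_closed B {x \<in> carrier B. \<phi> x \<in> ?N}"
    by (rule scott_continuous_vimage_closed)
  moreover have "e a \<in> {x \<in> carrier B. \<phi> x \<in> ?N}" if a: "a \<in> carrier A" "e a \<sqsubseteq>\<^bsub>B\<^esub> b" for a
  proof -
    have "f a \<in> \<phi> b" using a \<phi>_subset_iff[OF \<phi>_closed, of b b] by auto
    moreover have "\<phi> (e a) \<in> carrier (C_Gamma P)"
      using \<phi>_C_compact a e_closed by (simp add: C_Gamma_def)
    \<comment> \<open>The witness for \<open>tri_below\<close> is \<open>f a\<close>, because
      \<open>\<phi> (e a)\<close> equals \<open>down P (f a)\<close>.\<close>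
    ultimately show ?thesis
      using a e_closed \<phi>_e by (auto simp: nabla_C_def tri_below_def)
  qed
  ultimately have "b \<in> {x \<in> carrier B. \<phi> x \<in> ?N}"
    by (rule mem_closed_if_below[OF b])
  \<comment> \<open>That \<open>\<phi> b\<close> belongs to its own \<open>nabla_C\<close> means
    that it has a greatest element \<open>p\<close>.\<close>
  then obtain p where p: "p \<in> \<phi> b" "\<phi> b \<subseteq> down P p"
    by (auto simp: nabla_C_def tri_below_def)
  then have "p \<in> carrier P" "down P p \<subseteq> \<phi> b"
    using \<phi>_closed[of b] by (auto simp: scott_closed_def down_def)
  with p that show thesis by blast
qed

lemma extension:
  assumes wd: "weakly_dominated P"
  obtains g where "scott_continuous B P g" "\<And>a. a \<in> carrier A \<Longrightarrow> g (e a) = f a"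
proof -
  interpret P: partial_order P by (rule P)
  have "\<forall>b\<in>carrier B. \<exists>p. p \<in> carrier P \<and> \<phi> b = down P p"
    using \<phi>_principal[OF wd] by blast
  from bchoice[OF this] obtain g where g: "\<And>b. b \<in> carrier B \<Longrightarrow> g b \<in> carrier P"
    "\<And>b. b \<in> carrier B \<Longrightarrow> \<phi> b = down P (g b)" by blast
  \<comment> \<open>This equivalence moves questions about upper bounds in \<open>P\<close> to
    closed sets, where \<open>\<phi>_lub_subset\<close> answers them.\<close>
  have le_iff: "g b \<sqsubseteq>\<^bsub>P\<^esub> p \<longleftrightarrow> \<phi> b \<subseteq> down P p" if "b \<in> carrier B" "p \<in> carrier P" for b p
    using g that by (simp add: down_subset_down_iff[OF P])
  have mono: "g x \<sqsubseteq>\<^bsub>P\<^esub> g y" if "x \<in> carrier B" "y \<in> carrier B" "x \<sqsubseteq>\<^bsub>B\<^esub> y" for x y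
    using \<phi>_mono[OF that] le_iff[of x "g y"] g that by simp
  have "scott_continuous B P g"
    unfolding scott_continuous_def
  proof (intro conjI allI impI ballI)
    show "g \<in> carrier B \<rightarrow> carrier P" using g by auto
    fix D s assume D: "directed_in B D \<and> is_lub B s D"
    then have s: "s \<in> carrier B" and DB: "D \<subseteq> carrier B"
      by (auto simp: is_lub_iff directed_in_def)
    show "is_lub P (g s) (g ` D)"
      unfolding is_lub_iff
    proof (intro conjI ballI impI)
      show "g s \<in> carrier P" using g s by auto
      show "x \<sqsubseteq>\<^bsub>P\<^esub> g s" if "x \<in> g ` D \<inter> carrier P" for x
        using that D DB s mono by (auto simp: is_lub_iff)
      fix u assume u: "u \<in> carrier P" "\<forall>x\<in>g ` D \<inter> carrier P. x \<sqsubseteq>\<^bsub>P\<^esub> u"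
      have "\<phi> d \<subseteq> down P u" if "d \<in> D" for d
      proof -
        have d: "d \<in> carrier B" using that DB by blast
        then have "g d \<sqsubseteq>\<^bsub>P\<^esub> u" using u(2) that g(1)[OF d] by simp
        then show ?thesis using le_iff[OF d u(1)] by blast
      qed
      then have "\<phi> s \<subseteq> down P u"
        using \<phi>_lub_subset[OF _ _ scott_closed_down[OF P u(1)]] D by blast
      then show "g s \<sqsubseteq>\<^bsub>P\<^esub> u" using le_iff s u(1) by blast
    qed
  qed (use mono in auto)
  moreover have "g (e a) = f a" if a: "a \<in> carrier A" for a
  proof -
    have "down P (g (e a)) = down P (f a)" using \<phi>_e g(2) a e_closed by metis
    then show ?thesis
      using g(1) e_closed f_closed a by (intro P.le_antisym) (auto simp: down_def)
  qed
  ultimately show thesis by (rule that)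
qed

end

section \<open>The isomorphism of function spaces induced by a map in \<open>E2\<close>\<close>

theorem theorem6p11:
  shows "(\<forall>P :: 'c gorder. weakly_dominated P \<longrightarrow> P \<in> R2 TYPE('a) TYPE('b)) \<and>
         (WDomi :: 'c gorder set) \<subseteq> R2 TYPE('a) TYPE('b)"
proof -
  have "P \<in> R2 TYPE('a) TYPE('b)" if wd: "weakly_dominated P" for P :: "'c gorder"
  proof -
    have dP: "dcpo P" using wd by (simp add: weakly_dominated_def)
    then have P: "partial_order P" by (simp add: dcpo_def)
    interpret P: partial_order P by (rule P)
    have "dcpo_iso (fun_dcpo B P) (fun_dcpo A P) (precomp A e)" if e: "e \<in> E2 A B"
      for A :: "'a gorder" and B :: "'b gorder" and e
    proof -
      let ?F = "fun_dcpo B P" and ?G = "fun_dcpo A P"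
      have into: "precomp A e \<in> carrier ?F \<rightarrow> carrier ?G"
        using precomp_in_fun_dcpo[OF E2_continuous[OF e]] by blast
      have eB: "e a \<in> carrier B" if "a \<in> carrier A" for a
        using E2_continuous[OF e] that unfolding scott_continuous_def by auto
      have mono: "precomp A e g \<sqsubseteq>\<^bsub>?G\<^esub> precomp A e h \<longleftrightarrow> g \<sqsubseteq>\<^bsub>?F\<^esub> h"
        if "g \<in> carrier ?F" "h \<in> carrier ?F" for g h
        using E2_le_reflect[OF e P, of g h] that eB
        by (auto simp: fun_dcpo_def precomp_def compose_def)
      \<comment> \<open>Equal images are comparable both ways; \<open>mono\<close> reflects this to
        \<open>g\<close> and \<open>h\<close>, and antisymmetry in \<open>P\<close> finishes
        pointwise.\<close>
      have inj: "g = h"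
        if "g \<in> carrier ?F" "h \<in> carrier ?F" "precomp A e g = precomp A e h" for g h
      proof (rule extensionalityI[of _ "carrier B"])
        fix b assume b: "b \<in> carrier B"
        have refl: "k \<sqsubseteq>\<^bsub>?G\<^esub> k" if "k \<in> carrier ?G" for k
          using that by (auto simp: fun_dcpo_def scott_continuous_def)
        have "g \<sqsubseteq>\<^bsub>?F\<^esub> h" "h \<sqsubseteq>\<^bsub>?F\<^esub> g"
          using mono[of g h] mono[of h g] that into refl by auto
        then show "g b = h b"
          using b that by (auto simp: fun_dcpo_def scott_continuous_def intro!: P.le_antisym)
      qed (use that in \<open>auto simp: fun_dcpo_def\<close>)
      have surj: "\<exists>g\<in>carrier ?F. precomp A e g = h" if h: "h \<in> carrier ?G" for h
      proof -
        interpret E2_extension A B P e h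
          using e P h by unfold_locales (auto simp: fun_dcpo_def)
        obtain g where g: "scott_continuous B P g" "\<And>a. a \<in> carrier A \<Longrightarrow> g (e a) = h a"
          using extension[OF wd] by blast
        \<comment> \<open>The extension is fixed only on \<open>carrier B\<close>; restriction
          selects its representative in \<open>fun_dcpo B P\<close>.\<close>
        let ?g = "restrict g (carrier B)"
        have "?g \<in> carrier ?F"
          using g(1) scott_continuous_cong[of B ?g g P] by (simp add: fun_dcpo_def)
        moreover have "precomp A e ?g = h"
          using h g(2) eB
          by (intro extensionalityI[of _ "carrier A"])
            (auto simp: fun_dcpo_def precomp_def compose_def)
        ultimately show ?thesis by blast
      qed
      have bij: "bij_betw (precomp A e) (carrier ?F) (carrier ?G)"
        unfolding bij_betw_def inj_on_def using inj surj into by blast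
      show ?thesis
      proof (rule dcpo_isoI[OF into _ _ _ mono])
        show "inv_into (carrier ?F) (precomp A e) \<in> carrier ?G \<rightarrow> carrier ?F"
          using bij_betw_inv_into[OF bij] by (auto simp: bij_betw_def)
      qed (use bij in \<open>auto simp: bij_betw_inv_into_left bij_betw_inv_into_right\<close>)
    qed
    then show ?thesis using dP by (simp add: R2_def)
  qed
  then show ?thesis by (auto simp: WDomi_def)
qed

end
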